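(* Suppose $N$ and $0\le I<N$ are fixed. For $1\le k\le N$, let $\sigma_J(k,j)$ be the number of $\pi\in\mathfrak{S}_N$ with $J(\pi)=J$ that are $p$-acceptable, where $p\in\mathfrak{S}_k$ is a prefix with $p_k=k$ whose $J$-statistic is $j$ (if $k\le I$ the $J$-statistic of $p$ is undefined and $j$ plays no role). Then for $J=1,2,\dots,I+1$, $$\sigma_J(k,j)=\begin{cases}\dfrac{(N-I)(N-J-1)!\,(I-1)!}{(I-J)!\,(k-1)!}=\dfrac{1}{(k-1)!}M_J(N-1,I-1) & \text{if } 1\le k\le I \text{ and } J\le I,\\[2mm] \dfrac{(N-k)(N-J-1)!}{(k-J)!}=\dfrac{1}{(k-1)!}M_J(N-1,k-1) & \text{if } I+1\le k\le N \text{ and } J<j,\\[2mm] \dfrac{(N-j)!}{(k-j)!}=\displaystyle\sum_{T=j}^{N}\frac{1}{(k-1)!}M_T(N-1,k-1) & \text{if } I+1\le k\le N \text{ and } J=j,\\[2mm] 0 & \text{if } (k\le I \text{ and } J=I+1) \text{ or } (I+1\le k\le N \text{ and } J>j).\end{cases}$$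
   Context: Permutations are written as words; $\pi_i$ is the value in position $i$. A bottom-to-top maximum of a permutation is an entry whose position is to the right of the positions of all entries with smaller value. For a permutation $\pi\in\mathfrak{S}_n$ with $n>I$, the $J$-statistic $J(\pi)$ is the value of the next (leftmost) bottom-to-top maximum appearing in a position greater than $I$; it satisfies $1\le J(\pi)\le I+1$. For permutations of size at most $I$ the $J$-statistic is undefined. The flattening of a sequence of $i$ distinct integers is the permutation in $\mathfrak{S}_i$ with the same relative order. For a prefix $p\in\mathfrak{S}_k$, a permutation $\pi\in\mathfrak{S}_N$ is $p$-acceptable if the flattening of $\pi_1\cdots\pi_k$ equals $p$ and $\pi_k=N$. The count $\sigma_J(k,j)$ depends on $p$ only through its size $k$ and its $J$-statistic $j$. $M_J(n,i):=\dfrac{(n-i)\,i!\,(n-J)!}{(i-J+1)!}$, which for $0\le i<n$ is the total number of permutations in $\mathfrak{S}_n$ whose $J$-statistic, taken with respect to position $i$ in place of $I$, equals $J$.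
   Formalization: In the third row the formula for M_T(N-1,k-1) has factorials of negative integers; such terms with T>k are taken as 0, and the term T=k=N, which reads 0·(N-1)!·(-1)!/0!, is taken as (N-1)!, the value the stated equality forces. *)

theory Defs
  imports Complex_Main "HOL-Combinatorics.Multiset_Permutations"
begin

text \<open>
  A permutation in one-line notation is a list in \<open>permutations_of_set {1..n}\<close>.
  Positions are counted from 1.
\<close>

abbreviation perms :: "nat \<Rightarrow> nat list set" where
  "perms n \<equiv> permutations_of_set {1..n}"

definition entry :: "nat list \<Rightarrow> nat \<Rightarrow> nat" where
  "entry w i = w ! (i - 1)"

definition btt_max :: "nat list \<Rightarrow> nat \<Rightarrow> bool" where
  "btt_max w q \<longleftrightarrow> q \<in> {1..length w} \<and>
     (\<forall>r\<in>{1..length w}. entry w r < entry w q \<longrightarrow> r < q)"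

text \<open>
  The value is meaningful only if \<open>I < length w\<close>; otherwise there is no position to choose
  and the \<open>J\<close>-statistic is undefined.
\<close>

definition J_stat :: "nat \<Rightarrow> nat list \<Rightarrow> nat" where
  "J_stat I w = entry w (LEAST q. I < q \<and> btt_max w q)"

definition flatten :: "nat list \<Rightarrow> nat list" where
  "flatten xs = map (\<lambda>x. card {y \<in> set xs. y \<le> x}) xs"

lemma rank_less_iff:
  fixes x y :: nat
  assumes "finite A" "x \<in> A" "y \<in> A"
  shows "card {z \<in> A. z \<le> x} < card {z \<in> A. z \<le> y} \<longleftrightarrow> x < y"
proof
  assume "x < y"
  then have "{z \<in> A. z \<le> x} \<subseteq> {z \<in> A. z \<le> y}"
    and "y \<in> {z \<in> A. z \<le> y}" and "y \<notin> {z \<in> A. z \<le> x}"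
    using assms by auto
  then have "{z \<in> A. z \<le> x} \<subset> {z \<in> A. z \<le> y}" by blast
  then show "card {z \<in> A. z \<le> x} < card {z \<in> A. z \<le> y}"
    using assms by (intro psubset_card_mono) auto
next
  assume lt: "card {z \<in> A. z \<le> x} < card {z \<in> A. z \<le> y}"
  show "x < y"
  proof (rule ccontr)
    assume "\<not> x < y"
    then have "card {z \<in> A. z \<le> y} \<le> card {z \<in> A. z \<le> x}"
      using assms by (intro card_mono) auto
    then show False using lt by simp
  qed
qed

text \<open>
  \<open>flatten xs\<close> is the unique permutation of size \<open>length xs\<close> with the same relative order as
  \<open>xs\<close>.
\<close>

lemma flatten_same_order:
  assumes "a < length xs" "b < length xs"
  shows "flatten xs ! a < flatten xs ! b \<longleftrightarrow> xs ! a < xs ! b"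
  using assms by (simp add: flatten_def rank_less_iff)

lemma flatten_in_perms:
  assumes "distinct xs"
  shows "flatten xs \<in> perms (length xs)"
proof -
  let ?r = "\<lambda>x. card {y \<in> set xs. y \<le> x}"
  have inj: "inj_on ?r (set xs)"
  proof (rule inj_onI)
    fix x y assume xy: "x \<in> set xs" "y \<in> set xs" "?r x = ?r y"
    then have "\<not> x < y" and "\<not> y < x"
      using rank_less_iff[of "set xs" x y] rank_less_iff[of "set xs" y x] by simp_all
    then show "x = y" by simp
  qed
  have "?r x \<in> {1..length xs}" if x: "x \<in> set xs" for x
  proof -
    have "0 < ?r x" using x by (subst card_gt_0_iff) auto
    moreover have "?r x \<le> card (set xs)" by (rule card_mono) auto
    then have "?r x \<le> length xs" using distinct_card[OF assms] by simp
    ultimately show ?thesis unfolding atLeastAtMost_iff by linarith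
  qed
  then have "?r ` set xs \<subseteq> {1..length xs}" by blast
  moreover have "card (?r ` set xs) = card {1..length xs}"
    using inj assms by (simp add: card_image distinct_card)
  ultimately have "?r ` set xs = {1..length xs}" by (intro card_subset_eq) auto
  then show ?thesis
    unfolding flatten_def permutations_of_set_def mem_Collect_eq distinct_map set_map
    using inj assms by blast
qed

lemma flatten_perm:
  assumes "w \<in> perms n"
  shows "flatten w = w"
proof -
  have set_w: "set w = {1..n}" using assms by (simp add: permutations_of_set_def)
  have "card {y \<in> {1..n}. y \<le> x} = x" if "x \<in> {1..n}" for x
  proof -
    have "{y \<in> {1..n}. y \<le> x} = {1..x}" using that by auto
    then show ?thesis by simp
  qed
  then show ?thesis unfolding flatten_def set_w[symmetric] by (rule map_idI)
qed

lemma flatten_cong: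
  assumes len: "length u = length v" and du: "distinct u" and dv: "distinct v"
    and ord: "\<And>a b. a < length u \<Longrightarrow> b < length u \<Longrightarrow> u ! a < u ! b \<longleftrightarrow> v ! a < v ! b"
  shows "flatten u = flatten v"
proof -
  have rank: "card {y \<in> set w. y \<le> w ! a} = card {b. b < length w \<and> w ! b \<le> w ! a}"
    if "distinct w" for w :: "nat list" and a
  proof -
    have "{y \<in> set w. y \<le> w ! a} = (!) w ` {b. b < length w \<and> w ! b \<le> w ! a}"
      by (auto simp: in_set_conv_nth)
    moreover have "inj_on ((!) w) {b. b < length w \<and> w ! b \<le> w ! a}"
      using that by (auto simp: inj_on_def nth_eq_iff_index_eq)
    ultimately show ?thesis by (simp add: card_image)
  qed
  show ?thesis
  proof (rule nth_equalityI)
    fix a assume "a < length (flatten u)"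
    then have a: "a < length u" by (simp add: flatten_def)
    have "{b. b < length u \<and> u ! b \<le> u ! a} = {b. b < length v \<and> v ! b \<le> v ! a}"
      using ord[OF a] len by (auto simp: not_less[symmetric])
    then show "flatten u ! a = flatten v ! a"
      using a len rank[OF du] rank[OF dv] by (simp add: flatten_def)
  qed (simp add: flatten_def len)
qed

lemma flatten_eq_iff:
  assumes "distinct xs"
  shows "flatten xs = w \<longleftrightarrow> w \<in> perms (length xs) \<and>
    (\<forall>a<length xs. \<forall>b<length xs. w ! a < w ! b \<longleftrightarrow> xs ! a < xs ! b)"
proof
  assume "flatten xs = w"
  then show "w \<in> perms (length xs) \<and>
    (\<forall>a<length xs. \<forall>b<length xs. w ! a < w ! b \<longleftrightarrow> xs ! a < xs ! b)"
    using assms flatten_in_perms flatten_same_order by blast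
next
  assume R: "w \<in> perms (length xs) \<and>
    (\<forall>a<length xs. \<forall>b<length xs. w ! a < w ! b \<longleftrightarrow> xs ! a < xs ! b)"
  then have "distinct w" "length w = length xs"
    by (auto simp: permutations_of_set_def dest: distinct_card)
  then have "flatten xs = flatten w" using R assms by (intro flatten_cong) auto
  then show "flatten xs = w" using R flatten_perm by metis
qed

definition acceptable :: "nat \<Rightarrow> nat list \<Rightarrow> nat list \<Rightarrow> bool" where
  "acceptable N p w \<longleftrightarrow>
     flatten (take (length p) w) = p \<and> entry w (length p) = N"

definition sigma :: "nat \<Rightarrow> nat \<Rightarrow> nat \<Rightarrow> nat list \<Rightarrow> nat" where
  "sigma N I J p = card {w \<in> perms N. J_stat I w = J \<and> acceptable N p w}"

text \<open>
  \<open>M J n i\<close> is \<open>(n - i) i! (n - J)! / (i - J + 1)!\<close>. Factorials of negative integers occur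
  outside the range \<open>J \<le> min n (i + 1)\<close>. The reciprocal \<open>1 / (i - J + 1)!\<close> is 0 when
  \<open>J > i + 1\<close> (no permutation has such a \<open>J\<close>-statistic with respect to position \<open>i\<close>). For
  \<open>J = i + 1\<close> the factor \<open>(n - i) (n - J)!\<close> equals \<open>(n - i)!\<close>, which is also its value in the
  boundary case \<open>i = n\<close>, \<open>J = n + 1\<close>, where the formula would read \<open>0 * (-1)!\<close>. This gives
  \<open>M (n + 1) n n = n!\<close>: every permutation of size \<open>n\<close> has \<open>n + 1\<close> as the least positive
  integer not among its first \<open>n\<close> entries.
\<close>

definition M :: "nat \<Rightarrow> nat \<Rightarrow> nat \<Rightarrow> real" where
  "M J n i =
     (if J > i + 1 then 0
      else if i = n \<and> J = n + 1 then fact n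
      else (real n - real i) * fact i * fact (n - J) / fact (i + 1 - J))"

end

theory Submission
  imports Defs
begin

text \<open>
  The \<open>J\<close>-statistic of \<open>w\<close> is the least entry of \<open>w\<close> after position \<open>I\<close>, that is, the least
  positive integer missing from the first \<open>I\<close> entries. Put \<open>K = max k I\<close> and let \<open>C\<close> be the
  set of the first \<open>K\<close> entries of an acceptable \<open>w\<close>, so \<open>N \<in> C\<close>. Whether \<open>J\<close> is attained
  depends on \<open>C\<close> alone: if \<open>t\<close> is the least positive integer not in \<open>C\<close>, the statistic is
  \<open>t\<close> when \<open>k \<le> I\<close> and \<open>min t j\<close> when \<open>k > I\<close>. For each \<open>C\<close> there are
  \<open>((K - 1) choose (k - 1)) (K - k)! (N - K)!\<close> acceptable permutations, since the prefix is
  determined by its set of entries, and the possible sets \<open>C\<close> are counted by a binomial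
  coefficient.
\<close>

section \<open>The \<open>J\<close>-statistic as the least missing value\<close>

text \<open>Every entry smaller than the minimum after position \<open>I\<close> lies at a position
  at most \<open>I\<close>, so the minimum sits at a bottom-to-top maximum. A position strictly
  between \<open>I\<close> and it carries a larger entry with this smaller one to its right, so it
  does not qualify.\<close>

lemma J_stat_eq_Min:
  assumes "distinct w" "I < length w"
  shows "J_stat I w = Min (set (drop I w))"
proof -
  define v where "v = Min (set (drop I w))"
  have ne: "set (drop I w) \<noteq> {}" using assms by simp
  have "v \<in> set (drop I w)" unfolding v_def using ne by (intro Min_in) auto
  then obtain a where a: "a < length w - I" "v = w ! (I + a)"
    using assms by (auto simp: in_set_conv_nth)
  \<comment> \<open>The index \<open>a\<close> counts from 0 within \<open>drop I w\<close>;
    \<open>Suc\<close> converts to positions counted from 1.\<close>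
  define q where "q = Suc (I + a)"
  have v_min: "v \<le> w ! b" if "I \<le> b" "b < length w" for b
  proof -
    have "drop I w ! (b - I) \<in> set (drop I w)" using that by (intro nth_mem) auto
    then show ?thesis using that unfolding v_def by simp
  qed
  have ev: "entry w q = v" using a by (simp add: q_def entry_def)
  have q_le: "q \<le> length w" using a by (simp add: q_def)
  have "(LEAST q. I < q \<and> btt_max w q) = q"
  proof (rule Least_equality)
    have "r < q" if r: "r \<in> {1..length w}" "entry w r < entry w q" for r
    proof (rule ccontr)
      assume "\<not> r < q"
      then have "v \<le> w ! (r - 1)" using r by (intro v_min) (auto simp: q_def)
      then show False using r ev by (simp add: entry_def)
    qed
    then show "I < q \<and> btt_max w q" using q_le by (auto simp: q_def btt_max_def)
  next
    fix r assume r: "I < r \<and> btt_max w r"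
    show "q \<le> r"
    proof (rule ccontr)
      assume "\<not> q \<le> r"
      then have rq: "r < q" by simp
      have r_le: "r \<in> {1..length w}" using r by (simp add: btt_max_def)
      have "v \<le> w ! (r - 1)" using r r_le by (intro v_min) auto
      moreover have "w ! (r - 1) \<noteq> w ! (q - 1)"
        using assms r_le rq q_le by (subst nth_eq_iff_index_eq) auto
      ultimately have "entry w q < entry w r" using ev by (simp add: entry_def)
      moreover have "q \<in> {1..length w}" using q_le by (simp add: q_def)
      ultimately have "q < r" using r by (simp add: btt_max_def)
      then show False using rq by simp
    qed
  qed
  then show ?thesis using ev by (simp add: J_stat_def v_def)
qed

lemma permsD:
  assumes "w \<in> perms n"
  shows "set w = {1..n}" "distinct w" "length w = n"
  using assms by (auto simp: permutations_of_set_def dest: distinct_card)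

lemma J_stat_eq_iff:
  assumes w: "w \<in> perms N" and "I < N" "1 \<le> J" "J \<le> N"
  shows "J_stat I w = J \<longleftrightarrow> {1..<J} \<subseteq> set (take I w) \<and> J \<notin> set (take I w)"
proof -
  note D = permsD[OF w]
  have "set (take I w) \<union> set (drop I w) = {1..N}"
    using D by (metis append_take_drop_id set_append)
  moreover have "set (take I w) \<inter> set (drop I w) = {}"
    using D by (simp add: set_take_disj_set_drop_if_distinct)
  ultimately have drop: "set (drop I w) = {1..N} - set (take I w)" by blast
  have "set (drop I w) \<noteq> {}" using D assms by simp
  then have "J_stat I w = J \<longleftrightarrow>
      J \<in> set (drop I w) \<and> (\<forall>x\<in>set (drop I w). J \<le> x)"
    using D assms by (simp add: J_stat_eq_Min Min_eq_iff)
  also have "\<dots> \<longleftrightarrow> {1..<J} \<subseteq> set (take I w) \<and> J \<notin> set (take I w)"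
    unfolding drop
  proof (intro iffI conjI ballI subsetI)
    fix x assume L: "J \<in> {1..N} - set (take I w) \<and> (\<forall>x\<in>{1..N} - set (take I w). J \<le> x)"
      and x: "x \<in> {1..<J}"
    show "x \<in> set (take I w)"
    proof (rule ccontr)
      assume "x \<notin> set (take I w)"
      then have "x \<in> {1..N} - set (take I w)" using x assms by auto
      then have "J \<le> x" using L by blast
      then show False using x by simp
    qed
  next
    fix x assume R: "{1..<J} \<subseteq> set (take I w) \<and> J \<notin> set (take I w)"
      and x: "x \<in> {1..N} - set (take I w)"
    show "J \<le> x"
    proof (rule ccontr)
      assume "\<not> J \<le> x"
      then have "x \<in> {1..<J}" using x by simp
      then show False using R x by blast
    qed
  qed (use assms in auto)
  finally show ?thesis .
qed

lemma J_stat_bounds: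
  assumes w: "w \<in> perms N" and "I < N"
  shows "1 \<le> J_stat I w" "J_stat I w \<le> N" "J_stat I w \<le> I + 1"
proof -
  note D = permsD[OF w]
  have "J_stat I w = Min (set (drop I w))" using D assms by (simp add: J_stat_eq_Min)
  also have "\<dots> \<in> set (drop I w)" using D assms by (intro Min_in) auto
  also have "\<dots> \<subseteq> {1..N}" unfolding D(1)[symmetric] by (rule set_drop_subset)
  finally have "J_stat I w \<in> {1..N}" .
  then show bounds: "1 \<le> J_stat I w" "J_stat I w \<le> N" by auto
  \<comment> \<open>Pigeonhole: all values below the statistic must fit into the first
    \<open>I\<close> positions.\<close>
  have "{1..<J_stat I w} \<subseteq> set (take I w)"
    using J_stat_eq_iff[OF assms bounds] by simp
  then have "card {1..<J_stat I w} \<le> card (set (take I w))" by (intro card_mono) auto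
  also have "\<dots> \<le> I" using card_length[of "take I w"] by simp
  finally show "J_stat I w \<le> I + 1" by simp
qed

section \<open>Counting permutations by the set of their first entries\<close>

text \<open>Cutting after \<open>K\<close> entries gives \<open>w = u @ v\<close>, where
  \<open>u\<close> arranges a \<open>K\<close>-subset \<open>C\<close> and \<open>v\<close> arranges
  \<open>X - C\<close>. Since \<open>P\<close> sees only \<open>u\<close>, the choice of
  \<open>v\<close> is free and contributes the constant factorial.\<close>

lemma card_permutations_take:
  assumes fin: "finite X" and K: "K \<le> card X"
  shows "card {w \<in> permutations_of_set X. P (take K w)} =
    (\<Sum>C | C \<subseteq> X \<and> card C = K. card {u \<in> permutations_of_set C. P u}) * fact (card X - K)"
proof -
  define Cs where "Cs = {C. C \<subseteq> X \<and> card C = K}"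
  define W where
    "W C = {u \<in> permutations_of_set C. P u} \<times> permutations_of_set (X - C)" for C
  have finC: "finite C" if "C \<in> Cs" for C
    using that fin finite_subset by (auto simp: Cs_def)
  have len: "length u = K" if "C \<in> Cs" "(u, v) \<in> W C" for C u v
    using that by (auto simp: W_def Cs_def permutations_of_set_def dest: distinct_card)
  have union: "{w \<in> permutations_of_set X. P (take K w)} = (\<Union>C\<in>Cs. (\<lambda>(u, v). u @ v) ` W C)"
  proof (intro equalityI subsetI)
    fix w assume "w \<in> {w \<in> permutations_of_set X. P (take K w)}"
    then have w: "set w = X" "distinct w" "P (take K w)"
      by (auto simp: permutations_of_set_def)
    then have lw: "length w = card X" using distinct_card by fastforce
    have un: "set (take K w) \<union> set (drop K w) = X"
      using w by (metis append_take_drop_id set_append)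
    have dj: "set (take K w) \<inter> set (drop K w) = {}"
      using w by (simp add: set_take_disj_set_drop_if_distinct)
    have "set (take K w) \<in> Cs"
      using w lw un K by (auto simp: Cs_def distinct_card)
    moreover have "(take K w, drop K w) \<in> W (set (take K w))"
      using w un dj by (auto simp: W_def permutations_of_set_def)
    moreover have "w = (\<lambda>(u, v). u @ v) (take K w, drop K w)" by simp
    ultimately show "w \<in> (\<Union>C\<in>Cs. (\<lambda>(u, v). u @ v) ` W C)" by blast
  next
    fix w assume "w \<in> (\<Union>C\<in>Cs. (\<lambda>(u, v). u @ v) ` W C)"
    then obtain C u v where *: "C \<in> Cs" "(u, v) \<in> W C" "w = u @ v" by auto
    then show "w \<in> {w \<in> permutations_of_set X. P (take K w)}"
      using len[OF *(1,2)] by (auto simp: W_def Cs_def permutations_of_set_def)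
  qed
  have "card (\<Union>C\<in>Cs. (\<lambda>(u, v). u @ v) ` W C) = (\<Sum>C\<in>Cs. card ((\<lambda>(u, v). u @ v) ` W C))"
  proof (rule card_UN_disjoint)
    show "finite Cs" using fin by (simp add: Cs_def)
    show "\<forall>C\<in>Cs. finite ((\<lambda>(u, v). u @ v) ` W C)"
      using fin by (auto simp: W_def)
    show "\<forall>C\<in>Cs. \<forall>D\<in>Cs. C \<noteq> D \<longrightarrow>
        (\<lambda>(u, v). u @ v) ` W C \<inter> (\<lambda>(u, v). u @ v) ` W D = {}"
    proof (intro ballI impI, rule ccontr)
      fix C D assume CD: "C \<in> Cs" "D \<in> Cs" "C \<noteq> D"
        and "(\<lambda>(u, v). u @ v) ` W C \<inter> (\<lambda>(u, v). u @ v) ` W D \<noteq> {}"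
      then obtain u v u' v' where *: "(u, v) \<in> W C" "(u', v') \<in> W D" "u @ v = u' @ v'"
        by auto
      then have "u = u'" using len CD by (metis append_eq_append_conv)
      then show False using * CD by (auto simp: W_def permutations_of_set_def)
    qed
  qed
  also have "\<dots> = (\<Sum>C\<in>Cs. card {u \<in> permutations_of_set C. P u} * fact (card X - K))"
  proof (rule sum.cong[OF refl])
    fix C assume C: "C \<in> Cs"
    have "inj_on (\<lambda>(u, v). u @ v) (W C)"
    proof (rule inj_onI, clarify)
      fix u v u' v' assume "(u, v) \<in> W C" "(u', v') \<in> W C" "u @ v = u' @ v'"
      then show "u = u' \<and> v = v'" using len[OF C] by (simp add: append_eq_append_conv)
    qed
    then have "card ((\<lambda>(u, v). u @ v) ` W C) = card (W C)" by (rule card_image)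
    also have "\<dots> = card {u \<in> permutations_of_set C. P u} * fact (card X - K)"
      using C finC[OF C] fin by (simp add: W_def Cs_def card_cartesian_product card_Diff_subset)
    finally show "card ((\<lambda>(u, v). u @ v) ` W C) =
      card {u \<in> permutations_of_set C. P u} * fact (card X - K)" .
  qed
  finally show ?thesis unfolding union by (simp add: Cs_def sum_distrib_right)
qed

text \<open>Ranks determine elements of \<open>B\<close>, so \<open>flatten\<close> is injective on
  its arrangements. There are as many of these as permutations of size \<open>card B\<close>, so it
  is a bijection and \<open>p\<close> has exactly one preimage.\<close>

lemma card_permutations_flatten:
  assumes fin: "finite B" and p: "p \<in> perms (card B)"
  shows "card {u \<in> permutations_of_set B. flatten u = p} = 1"
proof -
  have len: "length u = card B" "distinct u" if "u \<in> permutations_of_set B" for u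
    using that by (auto simp: permutations_of_set_def dest: distinct_card)
  let ?r = "\<lambda>x. card {y \<in> B. y \<le> x}"
  have inj_r: "inj_on ?r B"
  proof (rule inj_onI)
    fix x y assume "x \<in> B" "y \<in> B" "?r x = ?r y"
    then show "x = y"
      using rank_less_iff[OF fin, of x y] rank_less_iff[OF fin, of y x] by simp
  qed
  have inj: "inj_on flatten (permutations_of_set B)"
  proof (rule inj_onI)
    fix u v assume uv: "u \<in> permutations_of_set B" "v \<in> permutations_of_set B"
      and "flatten u = flatten v"
    then have "map ?r u = map ?r v" by (simp add: flatten_def permutations_of_set_def)
    moreover have "set u = B" "set v = B" using uv by (auto simp: permutations_of_set_def)
    ultimately show "u = v" using inj_r by (simp add: inj_on_map_eq_map)
  qed
  have "flatten ` permutations_of_set B \<subseteq> perms (card B)"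
    using flatten_in_perms len by fastforce
  moreover have "card (flatten ` permutations_of_set B) = card (perms (card B))"
    using fin by (simp add: card_image[OF inj])
  ultimately have "flatten ` permutations_of_set B = perms (card B)"
    by (intro card_subset_eq) auto
  with p have "p \<in> flatten ` permutations_of_set B" by (simp only:)
  then obtain u where u: "u \<in> permutations_of_set B" "flatten u = p" by auto
  then have "{u \<in> permutations_of_set B. flatten u = p} = {u}"
    using inj by (auto simp: inj_on_def)
  then show ?thesis by simp
qed

text \<open>Deleting \<open>F\<close> from \<open>C\<close> leaves an arbitrary subset of
  \<open>U - F\<close> of size \<open>K - card F\<close>.\<close>

lemma card_subsets_containing:
  assumes fin: "finite U" and F: "F \<subseteq> U" and K: "card F \<le> K"
  shows "card {C. C \<subseteq> U \<and> card C = K \<and> F \<subseteq> C} = (card U - card F) choose (K - card F)"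
proof -
  have finF: "finite F" using fin F finite_subset by blast
  have "bij_betw (\<lambda>D. D \<union> F) {D. D \<subseteq> U - F \<and> card D = K - card F}
      {C. C \<subseteq> U \<and> card C = K \<and> F \<subseteq> C}"
  proof (rule bij_betw_byWitness[where f' = "\<lambda>C. C - F"])
    show "(\<lambda>D. D \<union> F) ` {D. D \<subseteq> U - F \<and> card D = K - card F}
        \<subseteq> {C. C \<subseteq> U \<and> card C = K \<and> F \<subseteq> C}"
    proof (rule image_subsetI)
      fix D assume D: "D \<in> {D. D \<subseteq> U - F \<and> card D = K - card F}"
      then have "finite D" using fin finite_subset by blast
      then have "card (D \<union> F) = K" using D finF K by (subst card_Un_disjoint) auto
      then show "D \<union> F \<in> {C. C \<subseteq> U \<and> card C = K \<and> F \<subseteq> C}" using D F by auto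
    qed
  qed (use finF in \<open>auto simp: card_Diff_subset\<close>)
  then have "card {C. C \<subseteq> U \<and> card C = K \<and> F \<subseteq> C} =
      card {D. D \<subseteq> U - F \<and> card D = K - card F}"
    by (simp add: bij_betw_same_card)
  also have "\<dots> = card (U - F) choose (K - card F)" using fin by (simp add: n_subsets)
  finally show ?thesis using finF F by (simp add: card_Diff_subset)
qed

text \<open>Cutting \<open>u\<close> after \<open>k\<close> entries, each \<open>k\<close>-subset of
  \<open>C\<close> through \<open>N\<close> admits exactly one arrangement with flattening
  \<open>p\<close>. The binomial coefficient counts these subsets and the factorial orders the rest
  of \<open>C\<close>.\<close>

lemma card_permutations_prefix:
  assumes fin: "finite C" and p: "p \<in> perms k" and "1 \<le> k" "k \<le> card C" and N: "N \<in> C"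
  shows "card {u \<in> permutations_of_set C. flatten (take k u) = p \<and> N \<in> set (take k u)} =
    ((card C - 1) choose (k - 1)) * fact (card C - k)"
proof -
  have "card {u \<in> permutations_of_set B. flatten u = p \<and> N \<in> set u} = of_bool (N \<in> B)"
    if B: "B \<subseteq> C" "card B = k" for B
  proof -
    have "finite B" using B fin finite_subset by blast
    moreover have "{u \<in> permutations_of_set B. flatten u = p \<and> N \<in> set u} =
        (if N \<in> B then {u \<in> permutations_of_set B. flatten u = p} else {})"
      by (auto simp: permutations_of_set_def)
    ultimately show ?thesis using card_permutations_flatten[of B p] p B by simp
  qed
  then have "(\<Sum>B | B \<subseteq> C \<and> card B = k.
        card {u \<in> permutations_of_set B. flatten u = p \<and> N \<in> set u}) =
      (\<Sum>B | B \<subseteq> C \<and> card B = k. of_bool (N \<in> B))"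
    by (intro sum.cong) auto
  also have "\<dots> = card {B. B \<subseteq> C \<and> card B = k \<and> {N} \<subseteq> B}"
    using fin by (simp add: sum.If_cases of_bool_def Int_def conj_assoc)
  also have "\<dots> = (card C - 1) choose (k - 1)"
    using assms by (subst card_subsets_containing) auto
  finally show ?thesis
    using card_permutations_take[OF fin \<open>k \<le> card C\<close>,
      of "\<lambda>u. flatten u = p \<and> N \<in> set u"] by simp
qed

section \<open>Reduction of \<open>sigma\<close> to counting sets of entries\<close>

text \<open>As \<open>p\<close> ends in its largest value, a \<open>w\<close> whose prefix flattens
  to \<open>p\<close> has the maximum of its first \<open>k\<close> entries at position
  \<open>k\<close>. Thus \<open>N\<close> is there as soon as it is among those entries, a condition
  on their set.\<close>

lemma acceptable_iff:
  assumes p: "p \<in> perms k" "entry p k = k" and k: "1 \<le> k" "k \<le> N"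
    and w: "w \<in> perms N"
  shows "acceptable N p w \<longleftrightarrow> flatten (take k w) = p \<and> N \<in> set (take k w)"
proof -
  note Dp = permsD[OF p(1)] and Dw = permsD[OF w]
  have last: "take k w ! (k - 1) = entry w k" using k by (simp add: entry_def)
  have "entry w k = N" if fl: "flatten (take k w) = p" and N: "N \<in> set (take k w)"
  proof (rule ccontr)
    assume ne: "entry w k \<noteq> N"
    obtain a where a: "a < k" "take k w ! a = N"
      using N Dw k by (auto simp: in_set_conv_nth)
    have "entry w k \<in> set w" using k Dw by (auto simp: entry_def)
    then have "entry w k < N" using ne Dw by auto
    then have "p ! (k - 1) < p ! a"
      using flatten_same_order[of "k - 1" "take k w" a] a last k Dw fl by simp
    moreover have "p ! a \<in> set p" using a Dp by (intro nth_mem) auto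
    ultimately show False using p Dp by (auto simp: entry_def)
  qed
  moreover have "N \<in> set (take k w)" if "entry w k = N"
    using that last k Dw by (metis diff_less length_take min.absorb2 nth_mem less_le_trans zero_less_one)
  ultimately show ?thesis using Dp by (auto simp: acceptable_def)
qed

text \<open>Grouping by the set \<open>C\<close> of the first \<open>K\<close> entries, every
  \<open>C\<close> that contains \<open>N\<close> and satisfies \<open>Q\<close> contributes the
  same number of permutations. The hypothesis on \<open>Q\<close> is restricted to acceptable
  \<open>w\<close> because for \<open>I < k\<close> the set of entries determines the statistic only
  once \<open>p\<close> is known.\<close>

lemma sigma_eq:
  assumes p: "p \<in> perms k" "entry p k = k" and k: "1 \<le> k" "k \<le> K" "K \<le> N"
    and Q: "\<And>w. \<lbrakk>w \<in> perms N; flatten (take k w) = p; N \<in> set (take k w)\<rbrakk> \<Longrightarrow>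
      J_stat I w = J \<longleftrightarrow> Q (set (take K w))"
  shows "sigma N I J p = card {C. C \<subseteq> {1..N} \<and> card C = K \<and> N \<in> C \<and> Q C} *
    ((K - 1) choose (k - 1)) * fact (K - k) * fact (N - K)"
proof -
  let ?A = "\<lambda>u. flatten (take k u) = p \<and> N \<in> set (take k u)"
  have "{w \<in> perms N. J_stat I w = J \<and> acceptable N p w} =
      {w \<in> perms N. Q (set (take K w)) \<and> ?A (take K w)}"
  proof (rule Collect_cong, rule conj_cong[OF refl])
    fix w assume w: "w \<in> perms N"
    have "take k (take K w) = take k w" using k by (simp add: min_def)
    then show "(J_stat I w = J \<and> acceptable N p w) = (Q (set (take K w)) \<and> ?A (take K w))"
      using acceptable_iff[OF p k(1) _ w] Q[OF w] k by auto
  qed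
  then have "sigma N I J p = (\<Sum>C | C \<subseteq> {1..N} \<and> card C = K.
      card {u \<in> permutations_of_set C. Q (set u) \<and> ?A u}) * fact (N - K)"
    unfolding sigma_def
    using card_permutations_take[of "{1..N}" K "\<lambda>u. Q (set u) \<and> ?A u"] k by simp
  also have "(\<Sum>C | C \<subseteq> {1..N} \<and> card C = K.
        card {u \<in> permutations_of_set C. Q (set u) \<and> ?A u}) =
      (\<Sum>C | C \<subseteq> {1..N} \<and> card C = K.
        if N \<in> C \<and> Q C then ((K - 1) choose (k - 1)) * fact (K - k) else 0)"
  proof (rule sum.cong[OF refl])
    fix C assume C: "C \<in> {C. C \<subseteq> {1..N} \<and> card C = K}"
    then have fin: "finite C" using finite_subset by blast
    show "card {u \<in> permutations_of_set C. Q (set u) \<and> ?A u} =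
        (if N \<in> C \<and> Q C then ((K - 1) choose (k - 1)) * fact (K - k) else 0)"
    proof (cases "N \<in> C \<and> Q C")
      case True
      then have "{u \<in> permutations_of_set C. Q (set u) \<and> ?A u} =
          {u \<in> permutations_of_set C. ?A u}"
        by (auto simp: permutations_of_set_def)
      then show ?thesis
        using card_permutations_prefix[OF fin p(1) k(1)] C True k by simp
    next
      case False
      then have empty: "{u \<in> permutations_of_set C. Q (set u) \<and> ?A u} = {}"
        by (auto simp: permutations_of_set_def dest: in_set_takeD)
      show ?thesis unfolding empty using False by auto
    qed
  qed
  also have "\<dots> = card {C. C \<subseteq> {1..N} \<and> card C = K \<and> N \<in> C \<and> Q C} *
      (((K - 1) choose (k - 1)) * fact (K - k))"
    by (simp add: sum.If_cases Int_def conj_assoc)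
  finally show ?thesis by simp
qed

section \<open>The \<open>J\<close>-statistic when the prefix reaches beyond position
  \<open>I\<close>\<close>

text \<open>With \<open>A\<close> and \<open>S\<close> the first \<open>k\<close> and first
  \<open>I\<close> entries of \<open>w\<close>, the first \<open>I\<close> entries of
  \<open>p\<close> are the ranks in \<open>A\<close> of the elements of \<open>S\<close>. Ranks
  agree with values up to the first gap of \<open>A\<close>, so \<open>p\<close> tells which of
  these small values lie in \<open>S\<close>. The statistic is therefore the smaller of
  \<open>j\<close> and the first gap; for \<open>J = j\<close> it does not matter whether
  \<open>j\<close> itself is in \<open>A\<close>.\<close>

lemma J_stat_eq_iff_prefix:
  assumes w: "w \<in> perms N" and I: "I < k" "k \<le> N" and J: "1 \<le> J" "J \<le> I + 1"
    and p: "p \<in> perms k" and fl: "flatten (take k w) = p" and j: "J_stat I p = j"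
  shows "J_stat I w = J \<longleftrightarrow>
    J \<le> j \<and> {1..<J} \<subseteq> set (take k w) \<and> (J < j \<longrightarrow> J \<notin> set (take k w))"
proof -
  note D = permsD[OF w]
  define A where "A = set (take k w)"
  define S where "S = set (take I w)"
  define r where "r x = card {y \<in> A. y \<le> x}" for x
  have finA: "finite A" by (simp add: A_def)
  have A: "A \<subseteq> {1..N}" using D set_take_subset by (metis A_def)
  have SA: "S \<subseteq> A" using I by (simp add: S_def A_def set_take_subset_set_take)
  have rS: "set (take I p) = r ` S"
  proof -
    have "take I p = map r (take I w)"
      using I by (simp add: fl[symmetric] flatten_def take_map A_def r_def min_def)
    then show ?thesis by (simp add: S_def)
  qed
  have r_inj: "x = y" if "x \<in> A" "y \<in> A" "r x = r y" for x y
    using that rank_less_iff[OF finA, of x y] rank_less_iff[OF finA, of y x]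
    by (simp add: r_def)
  have r_id: "r x = x" if "{1..<T} \<subseteq> A" "x \<in> A" "x \<le> T" for x T
  proof -
    have "{1..x} \<subseteq> insert x {1..<T}" using that by auto
    then have "{y \<in> A. y \<le> x} = {1..x}" using that A by auto
    then show ?thesis by (simp add: r_def)
  qed
  \<comment> \<open>If \<open>x = r y\<close> with \<open>y\<close> in \<open>S\<close>, then
    \<open>r y = r x\<close> by \<open>r_id\<close>, and injectivity on \<open>A\<close> gives
    \<open>y = x\<close>.\<close>
  have S_iff: "x \<in> S \<longleftrightarrow> x \<in> r ` S" if "{1..<T} \<subseteq> A" "x \<in> A" "x \<le> T" for x T
    using r_id[OF that] r_inj that(2) SA by (metis image_iff subsetD)
  have j_bd: "1 \<le> j" "j \<le> k" using J_stat_bounds[OF p I(1)] j by simp_all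
  have pj: "{1..<j} \<subseteq> r ` S" "j \<notin> r ` S"
    using J_stat_eq_iff[OF p I(1) j_bd] j rS by auto
  have "J_stat I w = J \<longleftrightarrow> {1..<J} \<subseteq> S \<and> J \<notin> S"
    using J_stat_eq_iff[OF w] I J by (simp add: S_def)
  also have "\<dots> \<longleftrightarrow> J \<le> j \<and> {1..<J} \<subseteq> A \<and> (J < j \<longrightarrow> J \<notin> A)"
  proof
    assume L: "{1..<J} \<subseteq> S \<and> J \<notin> S"
    then have JA: "{1..<J} \<subseteq> A" using SA by blast
    have "J \<le> j"
    proof (rule ccontr)
      assume "\<not> J \<le> j"
      \<comment> \<open>Then \<open>j\<close> would lie in \<open>S\<close> and equal its own rank,
        although \<open>j\<close> is missing from the first \<open>I\<close> entries of
        \<open>p\<close>.\<close>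
      then have "j \<in> {1..<J}" using j_bd by simp
      then have "j \<in> S" "j \<in> A" "j \<le> J" using L JA by auto
      then show False using S_iff[OF JA, of j] pj by blast
    qed
    moreover have "J \<notin> A" if "J < j"
      using S_iff[OF JA, of J] L pj that J by auto
    ultimately show "J \<le> j \<and> {1..<J} \<subseteq> A \<and> (J < j \<longrightarrow> J \<notin> A)" using JA by blast
  next
    assume R: "J \<le> j \<and> {1..<J} \<subseteq> A \<and> (J < j \<longrightarrow> J \<notin> A)"
    then have JA: "{1..<J} \<subseteq> A" by blast
    have "x \<in> S" if "x \<in> {1..<J}" for x
    proof -
      have "x \<in> A" "x \<le> J" "x \<in> {1..<j}" using JA R that by auto
      then show ?thesis using S_iff[OF JA, of x] pj by blast
    qed
    moreover have "J \<notin> S"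
    proof
      assume "J \<in> S"
      then have "J \<in> A" using SA by blast
      then have "J = j" using R by force
      then show False using S_iff[OF JA \<open>J \<in> A\<close>] \<open>J \<in> S\<close> pj by auto
    qed
    ultimately show "{1..<J} \<subseteq> S \<and> J \<notin> S" by blast
  qed
  finally show ?thesis by (simp add: A_def)
qed

section \<open>Counting the possible sets of entries\<close>

lemma card_subsets_initial_segment:
  assumes "1 \<le> J" "J \<le> K" "J \<le> N"
  shows "card {C. C \<subseteq> {1..N} \<and> card C = K \<and> N \<in> C \<and> {1..<J} \<subseteq> C} = (N - J) choose (K - J)"
proof -
  have "{C. C \<subseteq> {1..N} \<and> card C = K \<and> N \<in> C \<and> {1..<J} \<subseteq> C} =
      {C. C \<subseteq> {1..N} \<and> card C = K \<and> insert N {1..<J} \<subseteq> C}" by auto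
  \<comment> \<open>The bound \<open>J \<le> N\<close> keeps \<open>N\<close> out of
    \<open>{1..<J}\<close>, so exactly \<open>J\<close> elements are forced.\<close>
  moreover have "card (insert N {1..<J}) = J" using assms by (subst card_insert_disjoint) auto
  moreover have "insert N {1..<J} \<subseteq> {1..N}" using assms by auto
  ultimately show ?thesis
    using card_subsets_containing[of "{1..N}" "insert N {1..<J}" K] assms by simp
qed

text \<open>The element \<open>J\<close> is removed from the ground set, which loses one candidate;
  \<open>J < N\<close> ensures that the forced element \<open>N\<close> survives.\<close>

lemma card_subsets_least_missing:
  assumes "1 \<le> J" "J \<le> K" "J < N"
  shows "card {C. C \<subseteq> {1..N} \<and> card C = K \<and> N \<in> C \<and> {1..<J} \<subseteq> C \<and> J \<notin> C} =
    (N - J - 1) choose (K - J)"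
proof -
  have "{C. C \<subseteq> {1..N} \<and> card C = K \<and> N \<in> C \<and> {1..<J} \<subseteq> C \<and> J \<notin> C} =
      {C. C \<subseteq> {1..N} - {J} \<and> card C = K \<and> insert N {1..<J} \<subseteq> C}" by auto
  moreover have "card (insert N {1..<J}) = J" using assms by (subst card_insert_disjoint) auto
  moreover have "card ({1..N} - {J}) = N - 1" using assms by simp
  moreover have "insert N {1..<J} \<subseteq> {1..N} - {J}" using assms by auto
  ultimately show ?thesis
    using card_subsets_containing[of "{1..N} - {J}" "insert N {1..<J}" K] assms
    by (simp add: diff_commute)
qed

section \<open>The sum of the numbers \<open>M\<close>\<close>

text \<open>This is \<open>fact (N - k)\<close> times the hockey-stick identity, which sums
  \<open>(N - 1 - T) choose (k - T)\<close> over \<open>T\<close> from \<open>j\<close> to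
  \<open>k\<close> to \<open>(N - j) choose (k - j)\<close>. The induction lowers \<open>j\<close>
  from \<open>k\<close>.\<close>

lemma sum_fact_quotients:
  fixes j k N :: nat
  assumes "j \<le> k" "k < N"
  shows "(\<Sum>T = j..k. (real N - real k) * fact (N - 1 - T) / fact (k - T)) =
    fact (N - j) / fact (k - j)"
  using assms(1)
proof (induction j rule: inc_induct)
  case base
  have "fact (N - k) = real (N - k) * fact (N - 1 - k)"
    using assms by (subst fact_reduce) (auto simp: diff_commute)
  then show ?case using assms by (simp add: of_nat_diff)
next
  case (step j)
  have N_j: "fact (N - j) = real (N - j) * fact (N - 1 - j)"
    using step assms by (subst fact_reduce) (auto simp: diff_commute)
  have k_j: "fact (k - j) = real (k - j) * fact (k - Suc j)"
    using step by (subst fact_reduce) auto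
  have "(\<Sum>T = j..k. (real N - real k) * fact (N - 1 - T) / fact (k - T)) =
      (real N - real k) * fact (N - 1 - j) / fact (k - j) + fact (N - 1 - j) / fact (k - Suc j)"
    using step by (simp add: sum.atLeast_Suc_atMost[of j])
  \<comment> \<open>The sum supplied by the induction hypothesis is brought to the denominator of
    the new summand, so that the two coefficients add up to \<open>N - j\<close>.\<close>
  also have "fact (N - 1 - j) / fact (k - Suc j) = real (k - j) * fact (N - 1 - j) / fact (k - j)"
    unfolding k_j using step by simp
  also have "(real N - real k) * fact (N - 1 - j) / fact (k - j) + \<dots> =
      ((real N - real k) + real (k - j)) * fact (N - 1 - j) / fact (k - j)"
    by (simp only: add_divide_distrib distrib_right)
  also have "(real N - real k) + real (k - j) = real (N - j)"
    using step assms by (simp add: of_nat_diff)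
  finally show ?case by (simp only: N_j)
qed

lemma sum_M:
  assumes "1 \<le> j" "j \<le> k" "k \<le> N"
  shows "(\<Sum>T = j..N. 1 / fact (k - 1) * M T (N - 1) (k - 1)) = fact (N - j) / fact (k - j)"
proof (cases "k = N")
  \<comment> \<open>Here the factor \<open>n - i\<close> in \<open>M\<close> is zero, so only
    \<open>T = N\<close> survives, through the boundary value \<open>fact n\<close>.\<close>
  case True
  have "(\<Sum>T = j..N. 1 / fact (k - 1) * M T (N - 1) (k - 1)) =
      (\<Sum>T\<in>{N}. 1 / fact (k - 1) * M T (N - 1) (k - 1))"
    using assms True by (intro sum.mono_neutral_right) (auto simp: M_def)
  then show ?thesis using assms True by (simp add: M_def)
next
  case False
  \<comment> \<open>The terms with \<open>T > k\<close> vanish by the convention for reciprocal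
    factorials in \<open>M\<close>.\<close>
  have "(\<Sum>T = j..N. 1 / fact (k - 1) * M T (N - 1) (k - 1)) =
      (\<Sum>T = j..k. 1 / fact (k - 1) * M T (N - 1) (k - 1))"
    using assms by (intro sum.mono_neutral_right) (auto simp: M_def)
  also have "\<dots> = (\<Sum>T = j..k. (real N - real k) * fact (N - 1 - T) / fact (k - T))"
    using assms False by (intro sum.cong) (auto simp: M_def of_nat_diff)
  also have "\<dots> = fact (N - j) / fact (k - j)"
    using assms False by (intro sum_fact_quotients) auto
  finally show ?thesis .
qed

section \<open>Evaluation of \<open>sigma\<close> in the four cases\<close>

theorem theorem3p10:
  fixes N I J k j :: nat and p :: "nat list"
  assumes "I < N"
    and "1 \<le> k" and "k \<le> N"
    and "p \<in> perms k" and "entry p k = k"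
    and "I < k \<Longrightarrow> J_stat I p = j"
    and "1 \<le> J" and "J \<le> I + 1"
  shows
    "(1 \<le> k \<and> k \<le> I \<and> J \<le> I \<longrightarrow>
        real (sigma N I J p) =
          real (N - I) * fact (N - J - 1) * fact (I - 1) / (fact (I - J) * fact (k - 1)) \<and>
        real (N - I) * fact (N - J - 1) * fact (I - 1) / (fact (I - J) * fact (k - 1)) =
          1 / fact (k - 1) * M J (N - 1) (I - 1)) \<and>
     (I + 1 \<le> k \<and> k \<le> N \<and> J < j \<longrightarrow>
        real (sigma N I J p) = real (N - k) * fact (N - J - 1) / fact (k - J) \<and>
        real (N - k) * fact (N - J - 1) / fact (k - J) =
          1 / fact (k - 1) * M J (N - 1) (k - 1)) \<and>
     (I + 1 \<le> k \<and> k \<le> N \<and> J = j \<longrightarrow>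
        real (sigma N I J p) = fact (N - j) / fact (k - j) \<and>
        fact (N - j) / fact (k - j) =
          (\<Sum>T = j..N. 1 / fact (k - 1) * M T (N - 1) (k - 1))) \<and>
     ((k \<le> I \<and> J = I + 1) \<or> (I + 1 \<le> k \<and> k \<le> N \<and> J > j) \<longrightarrow>
        sigma N I J p = 0)"
proof -
  note p = assms(4,5)
  have J_N: "J \<le> N" using assms by simp
  have sigma_small: "sigma N I J p =
      card {C. C \<subseteq> {1..N} \<and> card C = I \<and> N \<in> C \<and> {1..<J} \<subseteq> C \<and> J \<notin> C} *
      ((I - 1) choose (k - 1)) * fact (I - k) * fact (N - I)"
    if "k \<le> I"
    \<comment> \<open>Here \<open>K\<close> is \<open>I\<close>: the first \<open>I\<close> entries
      include the whole prefix and decide the statistic.\<close>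
    by (rule sigma_eq[OF p assms(2) that less_imp_le[OF assms(1)]])
      (rule J_stat_eq_iff[OF _ assms(1,7) J_N])
  have sigma_large: "sigma N I J p = card {C. C \<subseteq> {1..N} \<and> card C = k \<and> N \<in> C \<and>
      J \<le> j \<and> {1..<J} \<subseteq> C \<and> (J < j \<longrightarrow> J \<notin> C)} * fact (N - k)"
    if "I < k"
  proof -
    have "sigma N I J p = card {C. C \<subseteq> {1..N} \<and> card C = k \<and> N \<in> C \<and>
        J \<le> j \<and> {1..<J} \<subseteq> C \<and> (J < j \<longrightarrow> J \<notin> C)} *
        ((k - 1) choose (k - 1)) * fact (k - k) * fact (N - k)"
      \<comment> \<open>Here \<open>K\<close> is \<open>k\<close>: the set of prefix entries
        together with \<open>p\<close> decides the statistic.\<close>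
      by (rule sigma_eq[OF p assms(2) order_refl assms(3)])
        (rule J_stat_eq_iff_prefix[OF _ that assms(3,7,8) p(1) _ assms(6)[OF that]])
    then show ?thesis by simp
  qed
  have case_small: "real (sigma N I J p) =
      real (N - I) * fact (N - J - 1) * fact (I - 1) / (fact (I - J) * fact (k - 1))"
    "real (N - I) * fact (N - J - 1) * fact (I - 1) / (fact (I - J) * fact (k - 1)) =
      1 / fact (k - 1) * M J (N - 1) (I - 1)"
    if "k \<le> I" "J \<le> I"
  proof -
    have sig: "sigma N I J p =
        ((N - J - 1) choose (I - J)) * ((I - 1) choose (k - 1)) * fact (I - k) * fact (N - I)"
      using sigma_small[OF that(1)] that card_subsets_least_missing[of J I N] assms by simp
    have b1: "real ((N - J - 1) choose (I - J)) =
        fact (N - J - 1) / (fact (I - J) * fact (N - I - 1))"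
      using that assms by (subst binomial_fact) auto
    have b2: "real ((I - 1) choose (k - 1)) = fact (I - 1) / (fact (k - 1) * fact (I - k))"
      using that assms by (subst binomial_fact) auto
    have f: "fact (N - I) = real (N - I) * fact (N - I - 1)"
      using assms by (subst fact_reduce) auto
    show "real (sigma N I J p) =
        real (N - I) * fact (N - J - 1) * fact (I - 1) / (fact (I - J) * fact (k - 1))"
      \<comment> \<open>The factorials of \<open>I - k\<close> and \<open>N - I - 1\<close> cancel,
        leaving the factor \<open>N - I\<close>.\<close>
      unfolding sig of_nat_mult of_nat_fact b1 b2 f by simp
    show "real (N - I) * fact (N - J - 1) * fact (I - 1) / (fact (I - J) * fact (k - 1)) =
        1 / fact (k - 1) * M J (N - 1) (I - 1)"
      using that assms by (simp add: M_def of_nat_diff diff_commute mult.commute mult.left_commute)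
  qed
  have case_less: "real (sigma N I J p) = real (N - k) * fact (N - J - 1) / fact (k - J)"
    "real (N - k) * fact (N - J - 1) / fact (k - J) = 1 / fact (k - 1) * M J (N - 1) (k - 1)"
    if "I < k" "J < j"
  proof -
    \<comment> \<open>Together with \<open>J < j\<close> and \<open>I < k\<close> this gives
      \<open>J < k\<close>, which avoids the exceptional branches of \<open>M\<close>.\<close>
    have "j \<le> I + 1" using J_stat_bounds(3)[OF p(1) that(1)] assms(6) that by simp
    then have J_less: "J < k" "J < N" using that assms by auto
    have "sigma N I J p = ((N - J - 1) choose (k - J)) * fact (N - k)"
      using sigma_large[OF that(1)] that card_subsets_least_missing[of J k N] assms J_less by simp
    moreover have "real ((N - J - 1) choose (k - J)) * fact (N - k) =
        real (N - k) * fact (N - J - 1) / fact (k - J)"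
    proof (cases "k = N")
      \<comment> \<open>Both sides are zero: the binomial coefficient would choose
        \<open>N - J\<close> elements from \<open>N - J - 1\<close>.\<close>
      case True
      then show ?thesis using J_less by (simp add: binomial_eq_0)
    next
      case False
      then have "real ((N - J - 1) choose (k - J)) =
          fact (N - J - 1) / (fact (k - J) * fact (N - k - 1))"
        using J_less assms by (subst binomial_fact) auto
      moreover have "fact (N - k) = real (N - k) * fact (N - k - 1)"
        using False assms by (subst fact_reduce) auto
      ultimately show ?thesis by simp
    qed
    ultimately show "real (sigma N I J p) = real (N - k) * fact (N - J - 1) / fact (k - J)"
      by simp
    show "real (N - k) * fact (N - J - 1) / fact (k - J) =
        1 / fact (k - 1) * M J (N - 1) (k - 1)"
      using J_less assms by (simp add: M_def of_nat_diff diff_commute)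
  qed
  have case_eq: "real (sigma N I J p) = fact (N - j) / fact (k - j)" if "I < k" "J = j"
  proof -
    have "sigma N I J p = ((N - j) choose (k - j)) * fact (N - k)"
      using sigma_large[OF that(1)] that card_subsets_initial_segment[of J k N] assms J_N by simp
    moreover have "real ((N - j) choose (k - j)) = fact (N - j) / (fact (k - j) * fact (N - k))"
      using that assms by (subst binomial_fact) auto
    ultimately show ?thesis by simp
  qed
  have case_top: "sigma N I J p = 0" if "k \<le> I" "J = I + 1"
  proof -
    have "{C. C \<subseteq> {1..N} \<and> card C = I \<and> N \<in> C \<and> {1..<J} \<subseteq> C \<and> J \<notin> C} = {}"
    proof -
      have False if C: "C \<subseteq> {1..N}" "card C = I" "N \<in> C" "{1..<J} \<subseteq> C" for C
      proof -
        have "finite C" using C finite_subset by blast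
        \<comment> \<open>The values up to \<open>I\<close> already fill all \<open>I\<close> places
          of \<open>C\<close>, leaving no room for \<open>N\<close>, which exceeds
          \<open>I\<close>.\<close>
        then have "{1..<J} = C" using C \<open>J = I + 1\<close> by (intro card_subset_eq) auto
        then show False using C \<open>J = I + 1\<close> assms by auto
      qed
      then show ?thesis by blast
    qed
    then show ?thesis
      using sigma_small[OF that(1)] by simp
  qed
  have case_greater: "sigma N I J p = 0" if "I < k" "j < J"
    using sigma_large[OF that(1)] that by simp
  have case_sum:
    "fact (N - j) / fact (k - j) = (\<Sum>T = j..N. 1 / fact (k - 1) * M T (N - 1) (k - 1))"
    if "I < k" "J = j"
    using that assms by (intro sum_M[symmetric]) auto
  have le_iff: "I + 1 \<le> k \<longleftrightarrow> I < k" by auto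
  show ?thesis
    unfolding le_iff
    by (intro conjI impI; (elim conjE disjE)?;
        (rule case_small case_less case_eq case_sum case_top case_greater; assumption))
qed

end
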